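(* Let $n\ge 1$ be a natural number and let $\mu$ be a finite measure on $\mathcal{T}=[0,1]$. Let $t_0\le\cdots\le t_{n-1}\in\mathcal{T}$ be such that $\bar t=(t_0,\ldots,t_{n-1})$ constitutes a Nash equilibrium in the producer game with fine preferences $(n,\mu,\succeq_F)$, and let $s$ be a mixed-consumption Nash equilibrium in the induced consumer game $(\mu;\bar t)$. If $\mu$ is atomless, then for every $j\in\mathbb{P}_n$, $s_j(d)=1$ for $\mu$-almost all consumer types $d\in\mathcal{T}$ such that $\mu\bigl([0,d)\bigr)\in\bigl(\frac{j}{n}\cdot\mu(\mathcal{T}),\frac{j+1}{n}\cdot\mu(\mathcal{T})\bigr)$.
   Context: Notation: $\mathcal{T}=[0,1]$ (with the Borel $\sigma$-algebra), $\mathbb{P}_n=\{0,1,\ldots,n-1\}$. Consumer game $(\mu;\bar t)$, for $\bar t=(t_0,\ldots,t_{n-1})\in\mathcal{T}^{\mathbb{P}_n}$. Consumers of types $d\in\mathcal{T}$ are distributed according to $\mu$. The strategies of type $d$ are $S_d=\{j\in\mathbb{P}_n\mid t_j\le d\}\cup\{\lnot\}$ ($\lnot$ means "not consuming"); $S=\mathbb{P}_n\cup\{\lnot\}$. A mixed-consumption profile is a measurable $s:\mathcal{T}\to[0,1]^S$ such that, for every $d$, $s(d)=(s_j(d))_{j\in S}$ is a probability vector on $S$ supported in $S_d$; its loads are $\ell^s_j=\int_{\mathcal{T}}s_j\,d\mu$. It is a Nash equilibrium if for every $d\in\mathcal{T}$: $\lnot\in\operatorname{supp}(s(d))$ only if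 $S_d=\{\lnot\}$, and $\ell^s_k\le\ell^s_j$ for all $k\in\operatorname{supp}(s(d))$, $j\in S_d\setminus\{\lnot\}$. Such equilibria exist and all have the same producer loads; $\ell_j(\bar t)$ denotes the load $\ell^s_j$ of producer $j\in\mathbb{P}_n$ in any such equilibrium $s$. Producer game with fine preferences $(n,\mu,\succeq_F)$: the players are the producers $\mathbb{P}_n$, each with pure-strategy set $\mathcal{T}$. Producer $j$ strictly prefers profile $\bar t$ to profile $\bar t'$ iff $\ell_j(\bar t)>\ell_j(\bar t')$, or $\ell_j(\bar t)=\ell_j(\bar t')$ and $t_j>t'_j$. *)

theory Defs
  imports "HOL-Analysis.Analysis"
begin

definition types :: "real set" where
  "types = {0..1}"

definition type_borel :: "real measure" where
  "type_borel = restrict_space borel types"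

definition atom :: "'a measure \<Rightarrow> 'a set \<Rightarrow> bool" where
  "atom M A \<longleftrightarrow> A \<in> sets M \<and> emeasure M A > 0 \<and>
     (\<forall>B\<in>sets M. B \<subseteq> A \<longrightarrow> emeasure M B = 0 \<or> emeasure M B = emeasure M A)"

definition atomless :: "'a measure \<Rightarrow> bool" where
  "atomless M \<longleftrightarrow> (\<nexists>A. atom M A)"

section \<open>Consumer game\<close>

text \<open>A consumption choice is an element of \<open>nat option\<close>: \<open>Some j\<close> is consuming at producer
  \<open>j\<close>, and \<open>None\<close> is not consuming. Profiles of thresholds are functions
  \<open>t :: nat \<Rightarrow> real\<close> of which only the values at \<open>j < n\<close> matter.\<close>

definition choices :: "nat \<Rightarrow> nat option set" where
  "choices n = Some ` {..<n} \<union> {None}"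

definition strategies :: "nat \<Rightarrow> (nat \<Rightarrow> real) \<Rightarrow> real \<Rightarrow> nat option set" where
  "strategies n t d = Some ` {j. j < n \<and> t j \<le> d} \<union> {None}"

definition support :: "nat \<Rightarrow> (nat option \<Rightarrow> real) \<Rightarrow> nat option set" where
  "support n p = {c \<in> choices n. p c \<noteq> 0}"

text \<open>Since \<open>choices n\<close> is finite, measurability into the product space is measurability of
  each coordinate.\<close>

definition mixed_profile ::
    "nat \<Rightarrow> (nat \<Rightarrow> real) \<Rightarrow> (real \<Rightarrow> nat option \<Rightarrow> real) \<Rightarrow> bool" where
  "mixed_profile n t s \<longleftrightarrow>
     (\<forall>c\<in>choices n. (\<lambda>d. s d c) \<in> borel_measurable type_borel) \<and>
     (\<forall>d\<in>types. (\<forall>c\<in>choices n. 0 \<le> s d c \<and> s d c \<le> 1) \<and>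
        (\<Sum>c\<in>choices n. s d c) = 1 \<and> support n (s d) \<subseteq> strategies n t d)"

definition load :: "real measure \<Rightarrow> (real \<Rightarrow> nat option \<Rightarrow> real) \<Rightarrow> nat \<Rightarrow> real" where
  "load \<mu> s j = (\<integral>d. s d (Some j) \<partial>\<mu>)"

definition consumer_equilibrium ::
    "nat \<Rightarrow> real measure \<Rightarrow> (nat \<Rightarrow> real) \<Rightarrow> (real \<Rightarrow> nat option \<Rightarrow> real) \<Rightarrow> bool" where
  "consumer_equilibrium n \<mu> t s \<longleftrightarrow> mixed_profile n t s \<and>
     (\<forall>d\<in>types.
        (None \<in> support n (s d) \<longrightarrow> strategies n t d = {None}) \<and>
        (\<forall>k j. Some k \<in> support n (s d) \<and> Some j \<in> strategies n t d
            \<longrightarrow> load \<mu> s k \<le> load \<mu> s j))"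

section \<open>Producer game with fine preferences\<close>

text \<open>For a finite Borel measure on \<open>types\<close> and thresholds in \<open>types\<close>, consumer equilibria exist
  and all have the same producer loads, so the description
  below picks the common value.\<close>

definition eq_load :: "nat \<Rightarrow> real measure \<Rightarrow> (nat \<Rightarrow> real) \<Rightarrow> nat \<Rightarrow> real" where
  "eq_load n \<mu> t j = (THE l. \<exists>s. consumer_equilibrium n \<mu> t s \<and> load \<mu> s j = l)"

definition fine_prefers ::
    "nat \<Rightarrow> real measure \<Rightarrow> nat \<Rightarrow> (nat \<Rightarrow> real) \<Rightarrow> (nat \<Rightarrow> real) \<Rightarrow> bool" where
  "fine_prefers n \<mu> j t t' \<longleftrightarrow>
     eq_load n \<mu> t j > eq_load n \<mu> t' j \<or>
     (eq_load n \<mu> t j = eq_load n \<mu> t' j \<and> t j > t' j)"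

definition fine_producer_equilibrium :: "nat \<Rightarrow> real measure \<Rightarrow> (nat \<Rightarrow> real) \<Rightarrow> bool" where
  "fine_producer_equilibrium n \<mu> t \<longleftrightarrow>
     (\<forall>j<n. t j \<in> types) \<and>
     (\<forall>j<n. \<forall>x\<in>types. \<not> fine_prefers n \<mu> j (t(j := x)) t)"

end

theory Submission
  imports Defs "HOL-Probability.Distribution_Functions" "HOL-Combinatorics.Permutations"
begin

text \<open>Write \<open>F x = \<mu> [0,x)\<close> and let \<open>M\<close> be the total mass. Two consumer equilibria with loads \<open>l\<close>
  and \<open>l'\<close> satisfy \<open>\<Sum> l\<^sub>j (l'\<^sub>j - l\<^sub>j) \<ge> 0\<close> and the symmetric inequality, whose sum forces \<open>l = l'\<close>;
  an equilibrium is obtained by cutting the types at quantiles given by the least concave majorant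
  of \<open>j \<mapsto> F (t j)\<close>. Hence the loads after a deviation are well defined.

  A producer who lowers its threshold to \<open>0\<close> is accessible to everybody and gets at least \<open>M / n\<close>,
  so in a producer equilibrium all loads equal \<open>M / n\<close>, and therefore \<open>F (t j) \<le> j M / n\<close>. If this
  inequality were strict, producer \<open>j\<close> could raise its threshold to some \<open>x\<close> with \<open>F x = j M / n\<close>
  without losing load, which it prefers. So \<open>F (t j) = j M / n\<close>: the types below \<open>t j\<close> exhaust the
  load of the producers below \<open>j\<close>, and almost all types between \<open>t j\<close> and \<open>t (j + 1)\<close> are left with
  producer \<open>j\<close> only.\<close>

section \<open>Least concave majorants and sorting\<close>

text \<open>\<open>P\<close> is the pointwise infimum of all concave majorants of \<open>f\<close>
  on the indices up to \<open>n\<close>; by the hypothesis the constant \<open>f n\<close> is one of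
  them. Minimality makes \<open>P\<close> touch \<open>f\<close> at both ends and be affine wherever
  it lies above \<open>f\<close>.\<close>

lemma least_concave_majorant:
  fixes f :: "nat \<Rightarrow> real"
  assumes max: "\<And>i. i \<le> n \<Longrightarrow> f i \<le> f n"
  obtains P where "P 0 = f 0" "P n = f n" "\<And>i. i \<le> n \<Longrightarrow> f i \<le> P i" "\<And>i. i \<le> n \<Longrightarrow> P i \<le> f n"
    "\<And>i. Suc i < n \<Longrightarrow> P i + P (Suc (Suc i)) \<le> 2 * P (Suc i)"
    "\<And>i. Suc i < n \<Longrightarrow> f (Suc i) < P (Suc i) \<Longrightarrow> P i + P (Suc (Suc i)) = 2 * P (Suc i)"
proof -
  define C where "C = {g :: nat \<Rightarrow> real. (\<forall>i\<le>n. f i \<le> g i) \<and>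
    (\<forall>i. Suc i < n \<longrightarrow> g i + g (Suc (Suc i)) \<le> 2 * g (Suc i))}"
  define P where "P = (\<lambda>i. INF g\<in>C. g i)"
  have const: "(\<lambda>_. f n) \<in> C"
    using max by (auto simp: C_def)
  have bdd: "bdd_below ((\<lambda>g. g i) ` C)" if "i \<le> n" for i
    using that by (intro bdd_belowI[of _ "f i"]) (auto simp: C_def)
  have P_le: "P i \<le> g i" if "g \<in> C" "i \<le> n" for g i
    unfolding P_def by (rule cINF_lower[OF bdd[OF that(2)] that(1)])
  have le_P: "x \<le> P i" if "\<And>g. g \<in> C \<Longrightarrow> x \<le> g i" for x i
    unfolding P_def using const that by (intro cINF_greatest) auto
  have f_le: "f i \<le> P i" if "i \<le> n" for i
    using that by (intro le_P) (auto simp: C_def)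
  have concave: "P i + P (Suc (Suc i)) \<le> 2 * P (Suc i)" if "Suc i < n" for i
  proof -
    have "(P i + P (Suc (Suc i))) / 2 \<le> P (Suc i)"
    proof (rule le_P)
      fix g assume g: "g \<in> C"
      then have "g i + g (Suc (Suc i)) \<le> 2 * g (Suc i)"
        using that by (auto simp: C_def)
      then show "(P i + P (Suc (Suc i))) / 2 \<le> g (Suc i)"
        using P_le[OF g, of i] P_le[OF g, of "Suc (Suc i)"] that by simp
    qed
    then show ?thesis by simp
  qed
  have "P \<in> C"
    using f_le concave by (auto simp: C_def)
  \<comment> \<open>Lowering a single value keeps the concavity inequalities at all other positions.\<close>
  have lower: "P k \<le> v" if "k \<le> n" "f k \<le> v" "v \<le> P k"
    "\<And>i. k = Suc i \<Longrightarrow> k < n \<Longrightarrow> P i + P (Suc k) \<le> 2 * v" for k v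
  proof -
    have "P(k := v) \<in> C"
      unfolding C_def
    proof (intro CollectI conjI allI impI)
      fix i assume "i \<le> n"
      then show "f i \<le> (P(k := v)) i" using f_le that by auto
    next
      fix i assume i: "Suc i < n"
      show "(P(k := v)) i + (P(k := v)) (Suc (Suc i)) \<le> 2 * (P(k := v)) (Suc i)"
        using concave[OF i] that i by (cases "k = Suc i") (auto simp: fun_upd_def)
    qed
    from P_le[OF this that(1)] show ?thesis by simp
  qed
  \<comment> \<open>No concavity inequality is centred at an end, so the last premise of
    \<open>lower\<close> is vacuous here.\<close>
  have "P 0 = f 0"
    using lower[of 0 "f 0"] f_le[of 0] by simp
  moreover have "P n = f n"
    using lower[of n "f n"] f_le[of n] by simp
  moreover have "P i \<le> f n" if "i \<le> n" for i
    using P_le[OF const that] by simp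
  moreover have "P i + P (Suc (Suc i)) = 2 * P (Suc i)"
    if "Suc i < n" "f (Suc i) < P (Suc i)" for i
  proof -
    \<comment> \<open>This is the least value that keeps both the majorant and the concavity
      condition at \<open>Suc i\<close>.\<close>
    have "P (Suc i) \<le> max (f (Suc i)) ((P i + P (Suc (Suc i))) / 2)"
    proof (rule lower)
      show "P j + P (Suc (Suc i)) \<le> 2 * max (f (Suc i)) ((P i + P (Suc (Suc i))) / 2)"
        if "Suc i = Suc j" for j
        using that by (simp add: max_def)
    qed (use concave[of i] that in auto)
    then show ?thesis
      using concave[of i] that by (auto simp: le_max_iff_disj)
  qed
  ultimately show ?thesis
    using that[of P] f_le concave by blast
qed

text \<open>A deviation may destroy the order of the thresholds; existence of consumer equilibria is
  reduced to sorted profiles by relabelling.\<close>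

lemma sorting_permutation:
  fixes t :: "nat \<Rightarrow> real"
  obtains \<pi> where "\<pi> permutes {..<n}" "mono_on {..<n} (t \<circ> \<pi>)"
proof -
  define xs where "xs = sort_key t [0..<n]"
  have xs: "length xs = n" "set xs = {..<n}" "distinct xs" "sorted (map t xs)"
    by (auto simp: xs_def)
  define \<pi> where "\<pi> i = (if i < n then xs ! i else i)" for i
  have "bij_betw \<pi> {..<n} {..<n}"
  proof -
    have "bij_betw (\<lambda>i. xs ! i) {..<n} {..<n}"
      using bij_betw_nth[OF xs(3)] xs by simp
    then show ?thesis
      by (subst bij_betw_cong[where g = "\<lambda>i. xs ! i"]) (auto simp: \<pi>_def)
  qed
  then have "\<pi> permutes {..<n}"
    by (rule bij_imp_permutes) (simp add: \<pi>_def)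
  moreover have "mono_on {..<n} (t \<circ> \<pi>)"
  proof (rule mono_onI)
    fix i j assume "i \<in> {..<n}" "j \<in> {..<n}" "i \<le> j"
    then show "(t \<circ> \<pi>) i \<le> (t \<circ> \<pi>) j"
      using sorted_nth_mono[OF xs(4), of i j] xs(1) by (simp add: \<pi>_def)
  qed
  ultimately show ?thesis by (rule that)
qed

section \<open>Finite measures on the type space\<close>

lemma sum_choices: "(\<Sum>c\<in>choices n. g c) = g None + (\<Sum>j<n. g (Some j))"
proof -
  have "choices n = insert None (Some ` {..<n})"
    by (auto simp: choices_def)
  then show ?thesis
    by (simp add: sum.reindex image_iff)
qed

locale consumer_measure = finite_measure \<mu> for \<mu> :: "real measure" +
  assumes sets_eq: "sets \<mu> = sets type_borel"
begin

abbreviation M :: real where "M \<equiv> measure \<mu> types"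

lemma space_eq: "space \<mu> = types"
  using sets_eq_imp_space_eq[OF sets_eq] by (simp add: type_borel_def space_restrict_space)

lemma measurable_eq: "borel_measurable \<mu> = borel_measurable type_borel"
  by (rule measurable_cong_sets) (simp_all add: sets_eq)

lemma sets_Int: "A \<in> sets borel \<Longrightarrow> A \<inter> types \<in> sets \<mu>"
  unfolding sets_eq type_borel_def
  by (subst sets_restrict_space) (auto simp: types_def)

lemma M_nonneg: "0 \<le> M"
  by simp

lemma integral_one: "(\<integral>d. 1 \<partial>\<mu>) = M"
  by (simp add: space_eq)

section \<open>The distribution function of the types\<close>

definition F :: "real \<Rightarrow> real" where
  "F x = measure \<mu> ({..<x} \<inter> types)"

lemma F_eq: "x \<in> types \<Longrightarrow> measure \<mu> {0..<x} = F x"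
  unfolding F_def by (rule arg_cong[where f = "measure \<mu>"]) (auto simp: types_def)

lemma F_mono: "x \<le> y \<Longrightarrow> F x \<le> F y"
  unfolding F_def by (intro finite_measure_mono sets_Int) auto

lemma F_nonneg: "0 \<le> F x"
  by (simp add: F_def)

lemma F_le: "F x \<le> M"
  unfolding F_def using sets_Int[of UNIV] by (intro finite_measure_mono) auto

text \<open>Arguments above \<open>1\<close> occur because the last cut point of a consumer
  equilibrium is placed above every type.\<close>

lemma F_top: "1 < x \<Longrightarrow> F x = M"
  unfolding F_def by (rule arg_cong[where f = "measure \<mu>"]) (auto simp: types_def)

lemma F_0: "F 0 = 0"
proof -
  have "{..<0} \<inter> types = {}" by (auto simp: types_def)
  then show ?thesis by (simp add: F_def)
qed

lemma measure_atLeast: "measure \<mu> ({x..} \<inter> types) = M - F x"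
proof -
  have "measure \<mu> (space \<mu> - ({..<x} \<inter> types)) = M - F x"
    unfolding F_def using sets_Int[of "{..<x}"] by (subst finite_measure_compl) (simp_all add: space_eq)
  moreover have "space \<mu> - ({..<x} \<inter> types) = {x..} \<inter> types"
    by (auto simp: space_eq)
  ultimately show ?thesis by simp
qed

lemma singleton_null:
  assumes "atomless \<mu>"
  shows "measure \<mu> ({x} \<inter> types) = 0"
proof -
  have "\<not> atom \<mu> ({x} \<inter> types)"
    using assms by (auto simp: atomless_def)
  moreover have "{x} \<inter> types \<in> sets \<mu>"
    by (rule sets_Int) auto
  moreover have "B = {} \<or> B = {x} \<inter> types" if "B \<subseteq> {x} \<inter> types" for B
    using that by auto
  ultimately have "\<not> 0 < emeasure \<mu> ({x} \<inter> types)"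
    unfolding atom_def by (metis emeasure_empty)
  then show ?thesis
    by (simp add: measure_def)
qed

text \<open>Points are null, so \<open>F\<close> is the \<open>cdf\<close> of the image of
  \<open>\<mu>\<close> on the reals, and a \<open>cdf\<close> is continuous wherever there is no
  point mass.\<close>

lemma F_cont:
  assumes "atomless \<mu>"
  shows "continuous_on UNIV F"
proof -
  define \<nu> where "\<nu> = distr \<mu> borel (\<lambda>x. x)"
  have meas: "(\<lambda>x. x) \<in> borel_measurable \<mu>"
    unfolding measurable_eq type_borel_def by (rule measurable_restrict_space1) simp
  have \<nu>: "measure \<nu> A = measure \<mu> (A \<inter> types)" if "A \<in> sets borel" for A
    using that by (simp add: \<nu>_def measure_distr[OF meas] space_eq)
  interpret \<nu>: finite_borel_measure \<nu>
    by (intro finite_borel_measure.intro finite_borel_measure_axioms.intro)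
      (auto simp: \<nu>_def intro!: finite_measure_distr meas)
  have "F = cdf \<nu>"
  proof
    fix x
    have "measure \<mu> ({..x} \<inter> types) = measure \<mu> (({..<x} \<inter> types) \<union> ({x} \<inter> types))"
      by (rule arg_cong[where f = "measure \<mu>"]) auto
    also have "\<dots> = F x + measure \<mu> ({x} \<inter> types)"
      unfolding F_def by (intro finite_measure_Union sets_Int) auto
    finally show "F x = cdf \<nu> x"
      using singleton_null[OF assms] by (simp add: cdf_def \<nu>)
  qed
  moreover have "isCont (cdf \<nu>) x" for x
    by (simp add: \<nu>.isCont_cdf \<nu> singleton_null[OF assms])
  ultimately show ?thesis
    by (simp add: continuous_at_imp_continuous_on)
qed

lemma F_1:
  assumes "atomless \<mu>"
  shows "F 1 = M"
proof -
  have "M = measure \<mu> (({..<1} \<inter> types) \<union> ({1} \<inter> types))"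
    by (rule arg_cong[where f = "measure \<mu>"]) (auto simp: types_def)
  also have "\<dots> = F 1 + measure \<mu> ({1} \<inter> types)"
    unfolding F_def by (intro finite_measure_Union sets_Int) auto
  finally show ?thesis
    using singleton_null[OF assms] by simp
qed

section \<open>Loads of consumption profiles\<close>

lemma profile_nonneg:
  "mixed_profile n t s \<Longrightarrow> d \<in> types \<Longrightarrow> c \<in> choices n \<Longrightarrow> 0 \<le> s d c"
  by (simp add: mixed_profile_def)

lemma profile_sum:
  "mixed_profile n t s \<Longrightarrow> d \<in> types \<Longrightarrow> s d None + (\<Sum>j<n. s d (Some j)) = 1"
  by (simp add: mixed_profile_def flip: sum_choices)

lemma profile_outside:
  assumes "mixed_profile n t s" "d \<in> types" "j < n" "d < t j"
  shows "s d (Some j) = 0"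
proof (rule ccontr)
  assume "s d (Some j) \<noteq> 0"
  then have "Some j \<in> support n (s d)"
    using assms by (simp add: support_def choices_def)
  then have "Some j \<in> strategies n t d"
    using assms(1,2) unfolding mixed_profile_def by blast
  then show False using assms by (simp add: strategies_def image_iff)
qed

lemma profile_integrable:
  assumes "mixed_profile n t s" "c \<in> choices n"
  shows "integrable \<mu> (\<lambda>d. s d c)"
proof (rule integrable_const_bound[where B = 1])
  show "AE d in \<mu>. norm (s d c) \<le> 1"
    using assms by (intro AE_I2) (auto simp: mixed_profile_def space_eq)
  show "(\<lambda>d. s d c) \<in> borel_measurable \<mu>"
    using assms by (auto simp: mixed_profile_def measurable_eq)
qed

lemma profile_integrable_Some:
  "mixed_profile n t s \<Longrightarrow> j < n \<Longrightarrow> integrable \<mu> (\<lambda>d. s d (Some j))"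
  by (rule profile_integrable) (auto simp: choices_def)

lemma profile_integrable_None:
  "mixed_profile n t s \<Longrightarrow> integrable \<mu> (\<lambda>d. s d None)"
  by (rule profile_integrable) (auto simp: choices_def)

lemma load_nonneg:
  assumes "mixed_profile n t s" "j < n"
  shows "0 \<le> load \<mu> s j"
  unfolding load_def using assms
  by (intro integral_nonneg_AE AE_I2 profile_nonneg) (auto simp: space_eq choices_def)

lemma total_load:
  assumes "mixed_profile n t s"
  shows "(\<integral>d. s d None \<partial>\<mu>) + (\<Sum>j<n. load \<mu> s j) = M"
proof -
  have "(\<integral>d. s d None \<partial>\<mu>) + (\<Sum>j<n. load \<mu> s j)
      = (\<integral>d. s d None + (\<Sum>j<n. s d (Some j)) \<partial>\<mu>)"
    using profile_integrable_Some[OF assms] profile_integrable_None[OF assms]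
    by (subst Bochner_Integration.integral_add) (auto simp: load_def)
  also have "\<dots> = (\<integral>d. 1 \<partial>\<mu>)"
    using profile_sum[OF assms] by (intro Bochner_Integration.integral_cong) (auto simp: space_eq)
  finally show ?thesis by (simp only: integral_one)
qed

lemma profile_sum_subset:
  assumes s: "mixed_profile n t s" and d: "d \<in> types" and K: "K \<subseteq> {..<n}"
    and "s d None = 0" "\<And>j. j < n \<Longrightarrow> j \<notin> K \<Longrightarrow> s d (Some j) = 0"
  shows "(\<Sum>j\<in>K. s d (Some j)) = 1"
proof -
  have "(\<Sum>j\<in>K. s d (Some j)) = (\<Sum>j<n. s d (Some j))"
    using assms by (intro sum.mono_neutral_left) auto
  then show ?thesis
    using profile_sum[OF s d] assms by simp
qed

lemma measure_le_load:
  assumes s: "mixed_profile n t s" and A: "A \<in> sets \<mu>" and K: "K \<subseteq> {..<n}"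
    and AE: "AE d in \<mu>. d \<in> A \<longrightarrow> (\<Sum>j\<in>K. s d (Some j)) = 1"
  shows "measure \<mu> A \<le> (\<Sum>j\<in>K. load \<mu> s j)"
proof -
  have int: "integrable \<mu> (\<lambda>d. \<Sum>j\<in>K. s d (Some j))"
    using profile_integrable_Some[OF s] K by (intro Bochner_Integration.integrable_sum) auto
  have "measure \<mu> A = (\<integral>d. indicator A d \<partial>\<mu>)"
    using sets.sets_into_space[OF A] by (simp add: Int_absorb2)
  also have "\<dots> \<le> (\<integral>d. (\<Sum>j\<in>K. s d (Some j)) \<partial>\<mu>)"
  proof (rule integral_mono_AE[OF _ int])
    show "integrable \<mu> (indicator A :: real \<Rightarrow> real)"
      using A by (simp add: integrable_indicator_iff less_top[symmetric])
    show "AE d in \<mu>. indicator A d \<le> (\<Sum>j\<in>K. s d (Some j))"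
      using AE AE_space
    proof eventually_elim
      case (elim d)
      have "0 \<le> (\<Sum>j\<in>K. s d (Some j))"
        using elim K by (intro sum_nonneg profile_nonneg[OF s]) (auto simp: space_eq choices_def)
      then show ?case using elim by (auto simp: indicator_def)
    qed
  qed
  also have "\<dots> = (\<Sum>j\<in>K. load \<mu> s j)"
    unfolding load_def using profile_integrable_Some[OF s] K
    by (intro Bochner_Integration.integral_sum) auto
  finally show ?thesis .
qed

section \<open>Uniqueness of the equilibrium loads\<close>

lemma equilibrium_None:
  assumes "consumer_equilibrium n \<mu> t s" "d \<in> types" "j < n" "t j \<le> d"
  shows "s d None = 0"
proof (rule ccontr)
  assume "s d None \<noteq> 0"
  then have "None \<in> support n (s d)"
    by (simp add: support_def choices_def)
  then have "strategies n t d = {None}"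
    using assms by (simp add: consumer_equilibrium_def)
  moreover have "Some j \<in> strategies n t d"
    using assms by (simp add: strategies_def)
  ultimately show False by simp
qed

lemma equilibrium_Some:
  assumes "consumer_equilibrium n \<mu> t s" "d \<in> types" "j < n" "t j \<le> d" "k < n"
    "load \<mu> s j < load \<mu> s k"
  shows "s d (Some k) = 0"
proof (rule ccontr)
  assume "s d (Some k) \<noteq> 0"
  then have "Some k \<in> support n (s d)"
    using assms by (simp add: support_def choices_def)
  moreover have "Some j \<in> strategies n t d"
    using assms by (simp add: strategies_def)
  ultimately have "load \<mu> s k \<le> load \<mu> s j"
    using assms(1,2) unfolding consumer_equilibrium_def by blast
  then show False using assms by simp
qed

text \<open>Each type in \<open>s\<close> uses only least loaded accessible producers, so it
  minimises the average of the loads of \<open>s\<close> over all its mixed choices, in particular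
  against \<open>s'\<close>. Integration over the types gives the claim.\<close>

lemma equilibrium_variational:
  assumes s: "consumer_equilibrium n \<mu> t s" and s': "consumer_equilibrium n \<mu> t s'"
  shows "(\<Sum>j<n. load \<mu> s j * load \<mu> s j) \<le> (\<Sum>j<n. load \<mu> s j * load \<mu> s' j)"
proof -
  have m: "mixed_profile n t s" and m': "mixed_profile n t s'"
    using s s' by (auto simp: consumer_equilibrium_def)
  let ?l = "load \<mu> s"
  have pw: "(\<Sum>j<n. ?l j * s d (Some j)) \<le> (\<Sum>j<n. ?l j * s' d (Some j))" if d: "d \<in> types" for d
  proof (cases "\<exists>i<n. t i \<le> d")
    case False
    then have "s d (Some j) = 0" "s' d (Some j) = 0" if "j < n" for j
      using profile_outside[OF m d that] profile_outside[OF m' d that] that by force+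
    then show ?thesis by simp
  next
    case True
    then have None: "s d None = 0" "s' d None = 0"
      using equilibrium_None[OF s d] equilibrium_None[OF s' d] by auto
    \<comment> \<open>Being used by \<open>s\<close>, this \<open>k\<close> has the least load among
      the producers accessible to \<open>d\<close>; both sums are compared with the constant weight
      \<open>?l k\<close>.\<close>
    then obtain k where k: "k < n" "s d (Some k) \<noteq> 0"
      using profile_sum[OF m d] by (metis add_0 lessThan_iff sum.neutral zero_neq_one)
    then have tk: "t k \<le> d"
      using profile_outside[OF m d] by force
    have "(\<Sum>j<n. ?l j * s d (Some j)) \<le> (\<Sum>j<n. ?l k * s d (Some j))"
    proof (rule sum_mono)
      fix j assume j: "j \<in> {..<n}"
      then show "?l j * s d (Some j) \<le> ?l k * s d (Some j)"
        using equilibrium_Some[OF s d k(1) tk, of j] profile_nonneg[OF m d, of "Some j"]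
        by (cases "?l k < ?l j") (auto simp: choices_def intro: mult_right_mono)
    qed
    also have "\<dots> = (\<Sum>j<n. ?l k * s' d (Some j))"
      using profile_sum[OF m d] profile_sum[OF m' d] None by (simp flip: sum_distrib_left)
    also have "\<dots> \<le> (\<Sum>j<n. ?l j * s' d (Some j))"
    proof (rule sum_mono)
      fix j assume j: "j \<in> {..<n}"
      show "?l k * s' d (Some j) \<le> ?l j * s' d (Some j)"
      proof (cases "t j \<le> d")
        case True
        then have "?l k \<le> ?l j"
          using equilibrium_Some[OF s d _ True k(1)] k(2) j by force
        then show ?thesis
          using profile_nonneg[OF m' d, of "Some j"] j
          by (auto simp: choices_def intro: mult_right_mono)
      next
        case False
        then show ?thesis using profile_outside[OF m' d, of j] j by simp
      qed
    qed
    finally show ?thesis .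
  qed
  have "(\<Sum>j<n. ?l j * ?l j) = (\<integral>d. (\<Sum>j<n. ?l j * s d (Some j)) \<partial>\<mu>)"
    using profile_integrable_Some[OF m] by (simp add: load_def)
  also have "\<dots> \<le> (\<integral>d. (\<Sum>j<n. ?l j * s' d (Some j)) \<partial>\<mu>)"
    using profile_integrable_Some[OF m] profile_integrable_Some[OF m'] pw
    by (intro integral_mono) (auto simp: space_eq)
  also have "\<dots> = (\<Sum>j<n. ?l j * load \<mu> s' j)"
    using profile_integrable_Some[OF m'] by (simp add: load_def)
  finally show ?thesis .
qed

lemma equilibrium_load_unique:
  assumes s: "consumer_equilibrium n \<mu> t s" and s': "consumer_equilibrium n \<mu> t s'"
    and j: "j < n"
  shows "load \<mu> s j = load \<mu> s' j"
proof -
  let ?l = "load \<mu> s" and ?l' = "load \<mu> s'"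
  \<comment> \<open>Grouped so that the sum of each bracket is nonpositive by one variational
    inequality.\<close>
  have square: "(a - b)\<^sup>2 = (a * a - a * b) + (b * b - b * a)" for a b :: real
    by (simp add: power2_eq_square algebra_simps)
  have "(\<Sum>j<n. (?l j - ?l' j)\<^sup>2) =
      ((\<Sum>j<n. ?l j * ?l j) - (\<Sum>j<n. ?l j * ?l' j)) + ((\<Sum>j<n. ?l' j * ?l' j) - (\<Sum>j<n. ?l' j * ?l j))"
    by (simp only: square sum.distrib sum_subtractf)
  also have "\<dots> \<le> 0"
    using equilibrium_variational[OF s s'] equilibrium_variational[OF s' s] by linarith
  finally have "(\<Sum>j<n. (?l j - ?l' j)\<^sup>2) = 0"
    by (meson antisym sum_nonneg zero_le_power2)
  then have "\<forall>j\<in>{..<n}. (?l j - ?l' j)\<^sup>2 = 0"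
    by (simp only: sum_nonneg_eq_0_iff[OF finite_lessThan zero_le_power2])
  then show ?thesis
    using j by simp
qed

lemma eq_load_eq:
  assumes "consumer_equilibrium n \<mu> t s" "j < n"
  shows "eq_load n \<mu> t j = load \<mu> s j"
  unfolding eq_load_def
proof (rule the_equality)
  show "\<exists>s'. consumer_equilibrium n \<mu> t s' \<and> load \<mu> s' j = load \<mu> s j"
    using assms(1) by blast
  show "l = load \<mu> s j" if "\<exists>s'. consumer_equilibrium n \<mu> t s' \<and> load \<mu> s' j = l" for l
    using that equilibrium_load_unique[OF _ assms] by blast
qed

section \<open>Existence of consumer equilibria\<close>

text \<open>Generalised inverse of \<open>F\<close>. Taking the least solution matters where
  \<open>F\<close> is flat: a threshold with mass \<open>y\<close> below it is then never exceeded
  by \<open>quantile y\<close>.\<close>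

definition quantile :: "real \<Rightarrow> real" where
  "quantile y = Inf {x \<in> types. y \<le> F x}"

lemma quantile:
  assumes al: "atomless \<mu>" and y: "0 \<le> y" "y \<le> M"
  shows "quantile y \<in> types" "F (quantile y) = y"
    "\<And>x. x \<in> types \<Longrightarrow> y \<le> F x \<Longrightarrow> quantile y \<le> x"
proof -
  let ?A = "{x \<in> types. y \<le> F x}"
  obtain z where z: "0 \<le> z" "z \<le> 1" "F z = y"
    using IVT'[of F 0 y 1] y F_0 F_1[OF al] continuous_on_subset[OF F_cont[OF al]]
    by (metis subset_UNIV zero_le_one)
  then have zA: "z \<in> ?A" by (simp add: types_def)
  have bdd: "bdd_below ?A"
    by (rule bdd_belowI[of _ 0]) (simp add: types_def)
  have "closed ?A"
  proof -
    have "?A = {0..1} \<inter> F -` {y..}" by (auto simp: types_def)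
    then show ?thesis
      using continuous_on_closed_vimage[of UNIV F] F_cont[OF al]
      by (metis closed_Int closed_UNIV closed_atLeast closed_atLeastAtMost inf_top_right)
  qed
  then have A: "quantile y \<in> ?A"
    unfolding quantile_def using zA bdd by (intro closed_contains_Inf) auto
  show le: "quantile y \<le> x" if "x \<in> types" "y \<le> F x" for x
    unfolding quantile_def using that bdd by (intro cInf_lower) auto
  show "quantile y \<in> types" using A by simp
  show "F (quantile y) = y"
    using A F_mono[OF le[of z]] zA z by auto
qed

text \<open>Producer \<open>i\<close> serves the types from \<open>p i\<close> up to
  \<open>p (Suc i)\<close>, and its load is the slope of the majorant there. Concavity makes loads
  decrease with the index, so no type envies a smaller index; it can reach a larger index only where
  the majorant is affine and the loads agree.\<close>

lemma equilibrium_exists_sorted: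
  assumes al: "atomless \<mu>" and n: "0 < n"
    and t: "\<And>j. j < n \<Longrightarrow> t j \<in> types" and mono: "mono_on {..<n} t"
  shows "\<exists>s. consumer_equilibrium n \<mu> t s"
proof -
  \<comment> \<open>The extra node \<open>n\<close> carries the total mass, so that the last
    producer serves all remaining types.\<close>
  define f where "f i = (if i < n then F (t i) else M)" for i
  obtain P where P0: "P 0 = f 0" and Pn: "P n = f n"
    and f_le: "\<And>i. i \<le> n \<Longrightarrow> f i \<le> P i" and P_le: "\<And>i. i \<le> n \<Longrightarrow> P i \<le> f n"
    and concave: "\<And>i. Suc i < n \<Longrightarrow> P i + P (Suc (Suc i)) \<le> 2 * P (Suc i)"
    and kink: "\<And>i. Suc i < n \<Longrightarrow> f (Suc i) < P (Suc i) \<Longrightarrow> P i + P (Suc (Suc i)) = 2 * P (Suc i)"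
    by (rule least_concave_majorant[of n f]) (auto simp: f_def F_le)
  define l where "l i = P (Suc i) - P i" for i
  have l_anti: "l k \<le> l j" if "j \<le> k" "k < n" for j k
    using that
  proof (induction k rule: dec_induct)
    case (step k)
    then show ?case using concave[of k] by (simp add: l_def)
  qed simp
  have l_nonneg: "0 \<le> l i" if "i < n" for i
  proof -
    have "0 \<le> l (n - 1)"
      using P_le[of "n - 1"] Pn n by (simp add: l_def)
    also have "\<dots> \<le> l i" using that by (intro l_anti) auto
    finally show ?thesis .
  qed
  have P_mono: "P j \<le> P k" if "j \<le> k" "k \<le> n" for j k
    using that
  proof (induction k rule: dec_induct)
    case (step k)
    then show ?case using l_nonneg[of k] by (simp add: l_def)
  qed simp
  have P_bounds: "0 \<le> P i" "P i \<le> M" if "i \<le> n" for i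
    using f_le[OF that] P_le[OF that] F_nonneg[of "t i"] M_nonneg
    by (auto simp: f_def split: if_splits)
  \<comment> \<open>Cut points: the mass below \<open>p i\<close> is \<open>P i\<close>. The maximum makes \<open>p i = t i\<close> exact, and not
    only up to a null set, whenever the majorant touches \<open>f\<close> at \<open>i\<close>.\<close>
  define p where "p i = (if i < n then max (t i) (quantile (P i)) else 2)" for i
  have F_p: "F (p i) = P i" if "i \<le> n" for i
  proof (cases "i < n")
    case True
    have "F (quantile (P i)) = P i"
      using quantile(2)[OF al P_bounds[OF that]] .
    \<comment> \<open>If \<open>t i\<close> exceeds the quantile, monotonicity gives the converse
      inequality, so the maximum still has mass \<open>P i\<close> below it.\<close>
    moreover have "F (t i) \<le> P i"
      using f_le[OF that] True by (simp add: f_def)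
    ultimately show ?thesis
      using True F_mono[of "t i" "quantile (P i)"] F_mono[of "quantile (P i)" "t i"]
      by (auto simp: p_def max_def)
  next
    case False
    then show ?thesis using that Pn F_top[of 2] by (simp add: p_def f_def)
  qed
  have t_le_p: "t i \<le> p i" if "i < n" for i
    using that by (simp add: p_def)
  have p_eq: "p i = t i" if "i < n" "P i = f i" for i
  proof -
    have "quantile (P i) \<le> t i"
      using that t P_bounds[of i] by (intro quantile(3)[OF al]) (auto simp: f_def)
    then show ?thesis using that by (simp add: p_def)
  qed
  have p_mono: "p j \<le> p k" if "j \<le> k" "k \<le> n" for j k
  proof (cases "k < n")
    case True
    have "quantile (P j) \<le> quantile (P k)"
    proof (rule quantile(3)[OF al])
      show "P j \<le> F (quantile (P k))"
        using quantile(2)[OF al P_bounds[OF that(2)]] P_mono[OF that] by simp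
    qed (use P_bounds that quantile(1)[OF al] in auto)
    moreover have "t j \<le> t k"
      using mono that True by (auto intro: mono_onD)
    ultimately show ?thesis using True that by (auto simp: p_def)
  next
    case False
    have "p j \<le> 2"
    proof (cases "j < n")
      case True
      then show ?thesis
        using t[OF True] quantile(1)[OF al P_bounds[of j]] by (auto simp: p_def types_def)
    qed (simp add: p_def)
    then show ?thesis using False by (simp add: p_def)
  qed
  \<comment> \<open>Differences of indicators make the probabilities telescope and the loads
    differences of \<open>F\<close>.\<close>
  define s where "s d c = (case c of Some j \<Rightarrow> of_bool (d < p (Suc j)) - of_bool (d < p j)
    | None \<Rightarrow> (of_bool (d < p 0) :: real))" for d :: real and c :: "nat option"
  have s_Some: "s d (Some j) = of_bool (p j \<le> d \<and> d < p (Suc j))" if "j < n" for d j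
    using p_mono[of j "Suc j"] that by (auto simp: s_def)
  have meas: "(\<lambda>d. of_bool (d < a) :: real) \<in> borel_measurable type_borel" for a :: real
  proof -
    have "(\<lambda>d. of_bool (d < a) :: real) = indicator {..<a}"
      by (auto simp: indicator_def)
    then show ?thesis
      unfolding type_borel_def by (auto intro!: measurable_restrict_space1)
  qed
  have profile: "mixed_profile n t s"
    unfolding mixed_profile_def
  proof (intro conjI ballI)
    fix c assume "c \<in> choices n"
    then show "(\<lambda>d. s d c) \<in> borel_measurable type_borel"
      using meas by (cases c) (simp_all add: s_def)
  next
    fix d c assume "d \<in> types" "c \<in> choices n"
    then show "0 \<le> s d c" "s d c \<le> 1"
      using s_Some[of _ d] by (auto simp: choices_def) (auto simp: s_def)
  next
    fix d assume d: "d \<in> types"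
    \<comment> \<open>The value \<open>2\<close> of \<open>p n\<close> ensures that type
      \<open>1\<close> is served as well.\<close>
    have "d < p n" using d by (simp add: p_def types_def)
    then show "(\<Sum>c\<in>choices n. s d c) = 1"
      using sum_lessThan_telescope[of "\<lambda>j. of_bool (d < p j) :: real" n]
      by (simp add: sum_choices s_def)
    show "support n (s d) \<subseteq> strategies n t d"
      using s_Some[of _ d] t_le_p by (force simp: support_def strategies_def choices_def)
  qed
  have load: "load \<mu> s j = l j" if "j < n" for j
  proof -
    have ind: "(\<integral>d. of_bool (d < a) \<partial>\<mu>) = F a" "integrable \<mu> (\<lambda>d. of_bool (d < a) :: real)" for a
    proof -
      have eq: "(\<lambda>d. of_bool (d < a) :: real) = indicator {..<a}"
        by (auto simp: indicator_def)
      show "(\<integral>d. of_bool (d < a) \<partial>\<mu>) = F a"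
        by (simp add: eq F_def space_eq)
      show "integrable \<mu> (\<lambda>d. of_bool (d < a) :: real)"
        using meas[of a] by (intro integrable_const_bound[where B = 1]) (auto simp: measurable_eq)
    qed
    have "load \<mu> s j = F (p (Suc j)) - F (p j)"
      unfolding load_def s_def by (simp add: ind)
    then show ?thesis using that F_p by (simp add: l_def)
  qed
  have "consumer_equilibrium n \<mu> t s"
    unfolding consumer_equilibrium_def
  proof (intro conjI profile ballI impI allI)
    fix d assume "None \<in> support n (s d)"
    then have "d < p 0"
      by (auto simp: support_def s_def)
    \<comment> \<open>The majorant touches \<open>f\<close> at \<open>0\<close>, so exactly the
      types below all thresholds abstain.\<close>
    then have "d < t 0" using p_eq[of 0] P0 n by simp
    then have "d < t j" if "j < n" for j
      using mono_onD[OF mono, of 0 j] that n by auto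
    then show "strategies n t d = {None}"
      by (force simp: strategies_def)
  next
    fix d k j assume "Some k \<in> support n (s d) \<and> Some j \<in> strategies n t d"
    then have k: "k < n" "d < p (Suc k)" and j: "j < n" "t j \<le> d"
      using s_Some[of k d] by (auto simp: support_def strategies_def choices_def split: if_splits)
    \<comment> \<open>A producer above \<open>k\<close> that is accessible to \<open>d\<close> has \<open>t i < p i\<close>, so the majorant has no
      kink there and the loads agree.\<close>
    have "l k = l i" if "k \<le> i" "i \<le> j" for i
      using that
    proof (induction i rule: dec_induct)
      case (step i)
      have "t (Suc i) \<le> t j"
        using step j by (intro mono_onD[OF mono]) auto
      then have "t (Suc i) < p (Suc i)"
        using p_mono[of "Suc k" "Suc i"] step j k by auto
      then have "f (Suc i) < P (Suc i)"
        using p_eq[of "Suc i"] f_le[of "Suc i"] step j by force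
      then show ?case
        using kink[of i] step j by (simp add: l_def)
    qed simp
    then have "k \<le> j \<Longrightarrow> l k = l j" by blast
    then show "load \<mu> s k \<le> load \<mu> s j"
      using l_anti[of j k] k j by (cases "j \<le> k") (auto simp: load)
  qed
  then show ?thesis by blast
qed

lemma equilibrium_permute:
  assumes \<pi>: "\<pi> permutes {..<n}" and s: "consumer_equilibrium n \<mu> (t \<circ> \<pi>) s"
  shows "consumer_equilibrium n \<mu> t (\<lambda>d c. s d (map_option (inv \<pi>) c))"
proof -
  define \<sigma> where "\<sigma> = inv \<pi>"
  let ?s = "\<lambda>d c. s d (map_option \<sigma> c)"
  have \<sigma>: "\<sigma> permutes {..<n}" and inv: "\<pi> (\<sigma> j) = j" "\<sigma> (\<pi> j) = j" for j
    using permutes_inv[OF \<pi>] permutes_inverses[OF \<pi>] by (auto simp: \<sigma>_def)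
  have less: "\<sigma> j < n \<longleftrightarrow> j < n" for j
    using permutes_in_image[OF \<sigma>, of j] by simp
  have choices: "map_option \<sigma> c \<in> choices n \<longleftrightarrow> c \<in> choices n" for c
    using less by (cases c) (auto simp: choices_def)
  have supp: "c \<in> support n (?s d) \<longleftrightarrow> map_option \<sigma> c \<in> support n (s d)" for c d
    using choices by (auto simp: support_def)
  have strat: "c \<in> strategies n t d \<longleftrightarrow> map_option \<sigma> c \<in> strategies n (t \<circ> \<pi>) d" for c d
    using less inv by (cases c) (auto simp: strategies_def)
  have m: "mixed_profile n (t \<circ> \<pi>) s"
    using s by (simp add: consumer_equilibrium_def)
  have "mixed_profile n t ?s"
    unfolding mixed_profile_def
  proof (intro conjI ballI)
    fix c assume "c \<in> choices n"
    then show "(\<lambda>d. ?s d c) \<in> borel_measurable type_borel"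
      using m choices[of c] by (simp add: mixed_profile_def)
  next
    fix d c assume "d \<in> types" "c \<in> choices n"
    then show "0 \<le> ?s d c" "?s d c \<le> 1"
      using m choices[of c] by (simp_all add: mixed_profile_def)
  next
    fix d assume d: "d \<in> types"
    have "(\<Sum>j<n. s d (Some (\<sigma> j))) = (\<Sum>j<n. s d (Some j))"
      using sum.permute[OF \<sigma>, of "\<lambda>j. s d (Some j)"] by (simp add: comp_def)
    then show "(\<Sum>c\<in>choices n. ?s d c) = 1"
      using profile_sum[OF m d] by (simp add: sum_choices)
    have "support n (s d) \<subseteq> strategies n (t \<circ> \<pi>) d"
      using m d by (simp add: mixed_profile_def)
    then show "support n (?s d) \<subseteq> strategies n t d"
      using supp strat by blast
  qed
  moreover have "load \<mu> ?s j = load \<mu> s (\<sigma> j)" for j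
    by (simp add: load_def)
  moreover have "strategies n t d = {None}" if "strategies n (t \<circ> \<pi>) d = {None}" for d
  proof -
    have "c = None" if "c \<in> strategies n t d" for c
      using strat[of c d] that \<open>strategies n (t \<circ> \<pi>) d = {None}\<close> by simp
    then show ?thesis by (auto simp: strategies_def)
  qed
  ultimately have "consumer_equilibrium n \<mu> t ?s"
    using s supp strat unfolding consumer_equilibrium_def by simp
  then show ?thesis by (simp add: \<sigma>_def)
qed

lemma equilibrium_exists:
  assumes "atomless \<mu>" "0 < n" "\<And>j. j < n \<Longrightarrow> t j \<in> types"
  obtains s where "consumer_equilibrium n \<mu> t s"
proof -
  obtain \<pi> where \<pi>: "\<pi> permutes {..<n}" "mono_on {..<n} (t \<circ> \<pi>)"
    by (rule sorting_permutation)
  have "\<pi> j < n" if "j < n" for j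
    using permutes_in_image[OF \<pi>(1), of j] that by simp
  then obtain s where "consumer_equilibrium n \<mu> (t \<circ> \<pi>) s"
    using equilibrium_exists_sorted[of n "t \<circ> \<pi>"] assms \<pi>(2) by auto
  from that[OF equilibrium_permute[OF \<pi>(1) this]] show ?thesis .
qed

section \<open>Equilibria of the producer game\<close>

text \<open>Everybody can reach \<open>j\<close>, so a producer with a larger load would be avoided
  by all types and have load \<open>0\<close>. Hence \<open>j\<close> has the maximal load, nobody
  abstains, and the maximum is at least the average.\<close>

lemma load_at_zero:
  assumes s: "consumer_equilibrium n \<mu> t s" and j: "j < n" "t j = 0"
  shows "M \<le> real n * load \<mu> s j"
proof -
  have m: "mixed_profile n t s"
    using s by (simp add: consumer_equilibrium_def)
  have tj: "t j \<le> d" if "d \<in> types" for d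
    using j that by (simp add: types_def)
  have "load \<mu> s k \<le> load \<mu> s j" if k: "k < n" for k
  proof (rule ccontr)
    assume "\<not> load \<mu> s k \<le> load \<mu> s j"
    then have less: "load \<mu> s j < load \<mu> s k" by simp
    have "load \<mu> s k = (\<integral>d. 0 \<partial>\<mu>)"
      unfolding load_def
      using equilibrium_Some[OF s _ j(1) tj k less]
      by (intro Bochner_Integration.integral_cong) (auto simp: space_eq)
    then show False using less load_nonneg[OF m j(1)] by simp
  qed
  then have "(\<Sum>k<n. load \<mu> s k) \<le> (\<Sum>k<n. load \<mu> s j)"
    by (intro sum_mono) auto
  moreover have "(\<integral>d. s d None \<partial>\<mu>) = (\<integral>d. 0 \<partial>\<mu>)"
    using equilibrium_None[OF s _ j(1) tj]
    by (intro Bochner_Integration.integral_cong) (auto simp: space_eq)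
  ultimately show ?thesis
    using total_load[OF m] by simp
qed

text \<open>The tie-break in favour of higher thresholds is what makes the bound strict for a raised
  threshold.\<close>

lemma deviation_load_le:
  assumes prod: "fine_producer_equilibrium n \<mu> t" and s: "consumer_equilibrium n \<mu> t s"
    and x: "x \<in> types" and s': "consumer_equilibrium n \<mu> (t(j := x)) s'" and j: "j < n"
  shows "load \<mu> s' j \<le> load \<mu> s j" "t j < x \<Longrightarrow> load \<mu> s' j < load \<mu> s j"
  using prod x j eq_load_eq[OF s j] eq_load_eq[OF s' j]
  by (force simp: fine_producer_equilibrium_def fine_prefers_def)+

text \<open>Deviating to threshold \<open>0\<close> guarantees each producer \<open>M / n\<close>,
  and the loads add up to at most \<open>M\<close>.\<close>

lemma equilibrium_loads_equal:
  assumes al: "atomless \<mu>" and prod: "fine_producer_equilibrium n \<mu> t"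
    and s: "consumer_equilibrium n \<mu> t s" and j: "j < n"
  shows "load \<mu> s j = M / n"
proof -
  have m: "mixed_profile n t s"
    using s by (simp add: consumer_equilibrium_def)
  have ge: "M / n \<le> load \<mu> s k" if k: "k < n" for k
  proof -
    have zero: "0 \<in> types" by (simp add: types_def)
    have "(t(k := 0)) i \<in> types" if "i < n" for i
      using prod zero that by (simp add: fine_producer_equilibrium_def)
    then obtain s' where s': "consumer_equilibrium n \<mu> (t(k := 0)) s'"
      using equilibrium_exists[OF al, of n "t(k := 0)"] k by auto
    have "M \<le> real n * load \<mu> s' k"
      by (rule load_at_zero[OF s' k]) simp
    also have "\<dots> \<le> real n * load \<mu> s k"
      using deviation_load_le(1)[OF prod s zero s' k] by (intro mult_left_mono) auto
    finally show ?thesis using k by (simp add: field_simps)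
  qed
  have "0 \<le> (\<integral>d. s d None \<partial>\<mu>)"
    by (intro integral_nonneg_AE AE_I2 profile_nonneg[OF m]) (auto simp: space_eq choices_def)
  then have "(\<Sum>k<n. load \<mu> s k - M / n) \<le> 0"
    using total_load[OF m] j by (simp add: sum_subtractf)
  moreover have "load \<mu> s j - M / n \<le> (\<Sum>k<n. load \<mu> s k - M / n)"
    using ge j by (intro member_le_sum) auto
  ultimately show ?thesis using ge[OF j] by simp
qed

lemma all_consume:
  assumes "atomless \<mu>" "fine_producer_equilibrium n \<mu> t" and s: "consumer_equilibrium n \<mu> t s"
    and n: "0 < n"
  shows "AE d in \<mu>. s d None = 0"
proof -
  have m: "mixed_profile n t s"
    using s by (simp add: consumer_equilibrium_def)
  have "(\<integral>d. s d None \<partial>\<mu>) = 0"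
    using total_load[OF m] equilibrium_loads_equal[OF assms(1-3)] n by simp
  moreover have "AE d in \<mu>. 0 \<le> s d None"
    by (intro AE_I2 profile_nonneg[OF m]) (auto simp: space_eq choices_def)
  ultimately show ?thesis
    using integral_nonneg_eq_0_iff_AE[OF profile_integrable_None[OF m]] by simp
qed

section \<open>Position of the thresholds\<close>

lemma low_types_choices:
  assumes al: "atomless \<mu>" and prod: "fine_producer_equilibrium n \<mu> t"
    and s: "consumer_equilibrium n \<mu> t s" and mono: "mono_on {..<n} t" and i: "i < n"
  shows "AE d in \<mu>. d < t i \<longrightarrow> (\<Sum>j<i. s d (Some j)) = 1"
  using all_consume[OF al prod s order.strict_trans1[OF le0 i]] AE_space
proof eventually_elim
  case (elim d)
  show ?case
  proof (intro impI profile_sum_subset)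
    show "mixed_profile n t s" using s by (simp add: consumer_equilibrium_def)
    fix j assume "d < t i" and j: "j < n" "j \<notin> {..<i}"
    then have "d < t j" using mono_onD[OF mono, of i j] i by auto
    then show "s d (Some j) = 0"
      using s elim j by (intro profile_outside) (auto simp: consumer_equilibrium_def space_eq)
  qed (use elim i in \<open>auto simp: space_eq\<close>)
qed

text \<open>The types below \<open>t i\<close> can reach only the \<open>i\<close> producers before
  it, whose loads are \<open>M / n\<close> each.\<close>

lemma F_threshold_le:
  assumes "atomless \<mu>" "fine_producer_equilibrium n \<mu> t"
    and s: "consumer_equilibrium n \<mu> t s" and "mono_on {..<n} t" and i: "i < n"
  shows "F (t i) \<le> i * (M / n)"
proof -
  have "F (t i) \<le> (\<Sum>j<i. load \<mu> s j)"
    unfolding F_def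
  proof (rule measure_le_load)
    show "mixed_profile n t s" using s by (simp add: consumer_equilibrium_def)
    show "{..<t i} \<inter> types \<in> sets \<mu>" by (rule sets_Int) simp
    show "AE d in \<mu>. d \<in> {..<t i} \<inter> types \<longrightarrow> (\<Sum>j<i. s d (Some j)) = 1"
      using low_types_choices[OF assms] by eventually_elim simp
  qed (use i in auto)
  also have "\<dots> = i * (M / n)"
    using equilibrium_loads_equal[OF assms(1-3)] i by simp
  finally show ?thesis .
qed

text \<open>Every type from \<open>t i\<close> on can reach \<open>i\<close> and therefore avoids
  all producers with load above \<open>b\<close>.\<close>

lemma measure_atLeast_le_load:
  assumes s: "consumer_equilibrium n \<mu> t s" and i: "i < n"
    and K: "K = {k \<in> {..<n}. load \<mu> s k \<le> b}" and b: "load \<mu> s i \<le> b"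
  shows "M - F (t i) \<le> (\<Sum>k\<in>K. load \<mu> s k)"
proof -
  have m: "mixed_profile n t s"
    using s by (simp add: consumer_equilibrium_def)
  have "(\<Sum>k\<in>K. s d (Some k)) = 1" if d: "d \<in> {t i..} \<inter> types" for d
  proof (rule profile_sum_subset[OF m])
    show "s d None = 0" using equilibrium_None[OF s _ i] d by auto
    show "s d (Some k) = 0" if "k < n" "k \<notin> K" for k
      using equilibrium_Some[OF s _ i _ that(1)] that b d by (auto simp: K)
  qed (use d K in auto)
  then have "measure \<mu> ({t i..} \<inter> types) \<le> (\<Sum>k\<in>K. load \<mu> s k)"
    using K by (intro measure_le_load[OF m] AE_I2 sets_Int) auto
  then show ?thesis by (simp add: measure_atLeast)
qed

text \<open>If the deviator were to fall below the average load, then the set \<open>K\<close> of producers with at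
  most its load would be too big to lie above \<open>j\<close>, and the types above the threshold of its
  least member would all have to consume in \<open>K\<close>.\<close>

lemma raised_threshold_load:
  assumes s: "consumer_equilibrium n \<mu> t s" and j: "j < n"
    and t: "\<And>i. i \<le> j \<Longrightarrow> F (t i) \<le> i * (M / n)"
  shows "M / n \<le> load \<mu> s j"
proof (rule ccontr)
  assume "\<not> M / n \<le> load \<mu> s j"
  then have less: "load \<mu> s j < M / n" by simp
  define K where "K = {k \<in> {..<n}. load \<mu> s k \<le> load \<mu> s j}"
  have jK: "j \<in> K" using j by (simp add: K_def)
  define i where "i = Min K"
  have K: "finite K" "K \<noteq> {}" using jK by (auto simp: K_def)
  have iK: "i \<in> K" and i_le: "i \<le> k" if "k \<in> K" for k
    using K that by (auto simp: i_def)
  have i: "i < n" "load \<mu> s i \<le> load \<mu> s j"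
    using iK[OF jK] by (auto simp: K_def)
  have "M - F (t i) \<le> (\<Sum>k\<in>K. load \<mu> s k)"
    using i by (intro measure_atLeast_le_load[OF s i(1) K_def])
  also have "\<dots> < (\<Sum>k\<in>K. M / n)"
    using less K by (intro sum_strict_mono) (auto simp: K_def)
  also have "\<dots> \<le> (n - i) * (M / n)"
  proof -
    have "K \<subseteq> {i..<n}" using i_le by (auto simp: K_def)
    then have "card K \<le> n - i" using card_mono[of "{i..<n}" K] by simp
    then show ?thesis using M_nonneg by (simp del: of_nat_diff add: divide_right_mono mult_right_mono)
  qed
  also have "\<dots> = M - i * (M / n)"
    using i by (simp add: of_nat_diff left_diff_distrib diff_divide_distrib)
  \<comment> \<open>The chain gives \<open>F (t i) > i * (M / n)\<close>, while
    \<open>i \<le> j\<close> because \<open>j\<close> belongs to \<open>K\<close>.\<close>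
  finally show False using t[OF i_le[OF jK]] by simp
qed

lemma F_threshold:
  assumes al: "atomless \<mu>" and prod: "fine_producer_equilibrium n \<mu> t"
    and s: "consumer_equilibrium n \<mu> t s" and mono: "mono_on {..<n} t" and j: "j < n"
  shows "F (t j) = j * (M / n)"
proof (rule ccontr)
  assume neq: "F (t j) \<noteq> j * (M / n)"
  have le: "F (t i) \<le> i * (M / n)" if "i < n" for i
    by (rule F_threshold_le[OF al prod s mono that])
  have tj: "t j \<in> types"
    using prod j by (simp add: fine_producer_equilibrium_def)
  have "j * (M / n) \<le> n * (M / n)"
    using j M_nonneg by (intro mult_right_mono) auto
  also have "\<dots> = F 1" using j by (simp add: F_1[OF al])
  finally obtain x where x: "t j \<le> x" "x \<le> 1" "F x = j * (M / n)"
    using IVT'[of F "t j" "j * (M / n)" 1] le[OF j] tj continuous_on_subset[OF F_cont[OF al]]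
    by (auto simp: types_def)
  then have less: "t j < x" and xt: "x \<in> types"
    using neq tj by (auto simp: types_def less_le)
  have "(t(j := x)) i \<in> types" if "i < n" for i
    using prod xt that by (simp add: fine_producer_equilibrium_def)
  then obtain s' where s': "consumer_equilibrium n \<mu> (t(j := x)) s'"
    using equilibrium_exists[OF al, of n "t(j := x)"] j by auto
  \<comment> \<open>The bounds hold up to index \<open>j\<close> in the deviated profile: smaller
    indices are unchanged, and at \<open>j\<close> there is equality by the choice of
    \<open>x\<close>.\<close>
  have "M / n \<le> load \<mu> s' j"
    using x le j by (intro raised_threshold_load[OF s' j]) auto
  then show False
    using deviation_load_le(2)[OF prod s xt s' j less] equilibrium_loads_equal[OF al prod s j]
    by simp
qed

text \<open>Accessibility alone does not keep types above \<open>t j\<close> away from cheaper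
  producers; exhausted loads do.\<close>

lemma high_types_choices:
  assumes al: "atomless \<mu>" and prod: "fine_producer_equilibrium n \<mu> t"
    and s: "consumer_equilibrium n \<mu> t s" and mono: "mono_on {..<n} t" and j: "j < n"
  shows "AE d in \<mu>. t j \<le> d \<longrightarrow> (\<forall>i<j. s d (Some i) = 0)"
proof -
  have m: "mixed_profile n t s"
    using s by (simp add: consumer_equilibrium_def)
  define A where "A = {..<t j} \<inter> types"
  have A: "A \<in> sets \<mu>" unfolding A_def by (rule sets_Int) simp
  have nonneg: "0 \<le> s d (Some i)" if "d \<in> types" "i < j" for d i
    using profile_nonneg[OF m that(1), of "Some i"] that j by (auto simp: choices_def)
  \<comment> \<open>The types below \<open>t j\<close> already use up the whole load of the producers below \<open>j\<close>.\<close>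
  let ?h = "\<lambda>d. (\<Sum>i<j. s d (Some i)) - indicator A d"
  have int: "integrable \<mu> (\<lambda>d. \<Sum>i<j. s d (Some i))" "integrable \<mu> (indicator A :: real \<Rightarrow> real)"
    using profile_integrable_Some[OF m] j A
    by (auto simp: integrable_indicator_iff less_top[symmetric])
  have "(\<integral>d. ?h d \<partial>\<mu>) = (\<integral>d. (\<Sum>i<j. s d (Some i)) \<partial>\<mu>) - (\<integral>d. indicator A d \<partial>\<mu>)"
    by (rule Bochner_Integration.integral_diff[OF int])
  also have "(\<integral>d. (\<Sum>i<j. s d (Some i)) \<partial>\<mu>) = (\<Sum>i<j. load \<mu> s i)"
    unfolding load_def using profile_integrable_Some[OF m] j
    by (intro Bochner_Integration.integral_sum) auto
  also have "(\<integral>d. indicator A d \<partial>\<mu>) = F (t j)"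
    using sets.sets_into_space[OF A] by (simp add: Int_absorb2 A_def F_def)
  finally have "(\<integral>d. ?h d \<partial>\<mu>) = 0"
    using F_threshold[OF assms] equilibrium_loads_equal[OF al prod s] j by simp
  moreover have "AE d in \<mu>. 0 \<le> ?h d"
    using low_types_choices[OF assms] AE_space
  proof eventually_elim
    case (elim d)
    have "0 \<le> (\<Sum>i<j. s d (Some i))"
      using elim nonneg by (intro sum_nonneg) (auto simp: space_eq)
    then show ?case using elim by (auto simp: A_def indicator_def)
  qed
  ultimately have "AE d in \<mu>. ?h d = 0"
    using integral_nonneg_eq_0_iff_AE[OF Bochner_Integration.integrable_diff[OF int]] by simp
  then show ?thesis
    using AE_space
  proof eventually_elim
    case (elim d)
    show ?case
    proof
      assume "t j \<le> d"
      then have "(\<Sum>i<j. s d (Some i)) = 0"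
        using elim by (simp add: A_def)
      then show "\<forall>i<j. s d (Some i) = 0"
        using elim nonneg by (subst (asm) sum_nonneg_eq_0_iff) (auto simp: space_eq)
    qed
  qed
qed

text \<open>The condition on \<open>F d\<close> places \<open>d\<close> between \<open>t j\<close>
  and the next threshold, if there is one. Producers above \<open>j\<close> are then inaccessible,
  and those below have no load left for such types.\<close>

lemma fine_equilibrium_choices:
  assumes al: "atomless \<mu>" and prod: "fine_producer_equilibrium n \<mu> t"
    and s: "consumer_equilibrium n \<mu> t s" and mono: "mono_on {..<n} t" and j: "j < n"
  shows "AE d in \<mu>. F d \<in> {j * (M / n) <..< Suc j * (M / n)} \<longrightarrow> s d (Some j) = 1"
proof -
  have m: "mixed_profile n t s"
    using s by (simp add: consumer_equilibrium_def)
  note F = F_threshold[OF al prod s mono]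
  have "AE d in \<mu>. s d None = 0"
    using all_consume[OF al prod s] j by simp
  then show ?thesis
    using high_types_choices[OF assms] AE_space
  proof eventually_elim
    case (elim d)
    then have d: "d \<in> types" by (simp add: space_eq)
    show ?case
    proof
      assume Fd: "F d \<in> {j * (M / n) <..< Suc j * (M / n)}"
      have tj: "t j \<le> d"
        using F_mono[of d "t j"] F[OF j] Fd by force
      have "s d (Some k) = 0" if "k < n" "k \<notin> {j}" for k
      proof (cases "k < j")
        case True
        then show ?thesis using elim tj by simp
      next
        case False
        \<comment> \<open>A producer above \<open>j\<close> exists here, so the threshold
          \<open>t (Suc j)\<close> is a genuine one.\<close>
        then have k: "Suc j \<le> k" "Suc j < n" using that by auto
        then have "t (Suc j) \<le> t k"
          using that by (intro mono_onD[OF mono]) auto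
        moreover have "d < t (Suc j)"
          using F_mono[of "t (Suc j)" d] F[OF k(2)] Fd by force
        ultimately show ?thesis
          using profile_outside[OF m d that(1)] by simp
      qed
      then have "(\<Sum>k\<in>{j}. s d (Some k)) = 1"
        using elim j by (intro profile_sum_subset[OF m d]) auto
      then show "s d (Some j) = 1" by simp
    qed
  qed
qed

end

theorem theorem4p31:
  fixes n :: nat and \<mu> :: "real measure" and t :: "nat \<Rightarrow> real"
    and s :: "real \<Rightarrow> nat option \<Rightarrow> real"
  assumes "n \<ge> 1"
    and "sets \<mu> = sets type_borel"
    and "finite_measure \<mu>"
    and "mono_on {..<n} t"
    and "fine_producer_equilibrium n \<mu> t"
    and "consumer_equilibrium n \<mu> t s"
    and "atomless \<mu>"
  shows "\<forall>j<n. AE d in \<mu>.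
    measure \<mu> {0..<d} \<in> {real j / real n * measure \<mu> types <..<
                         real (j + 1) / real n * measure \<mu> types}
      \<longrightarrow> s d (Some j) = 1"
proof (intro allI impI)
  interpret consumer_measure \<mu>
    using assms(2,3) by (intro consumer_measure.intro consumer_measure_axioms.intro)
  fix j assume "j < n"
  from fine_equilibrium_choices[OF assms(7,5,6,4) this] AE_space
  show "AE d in \<mu>. measure \<mu> {0..<d} \<in> {real j / real n * measure \<mu> types <..<
      real (j + 1) / real n * measure \<mu> types} \<longrightarrow> s d (Some j) = 1"
    by eventually_elim (simp add: space_eq F_eq)
qed

end
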